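(* The following four pairs $(X_1,X_2)$ of subsets of $\mathbb{Z}_{58}$ are four pairwise non-equivalent supplementary difference sets (SDS) with parameters $(58;27,24;22)$: (1) $X_1=\{0,1,2,3,4,7,8,10,11,12,13,16,18,20,24,26,29,31,32,33,36,38,43,46,47,50,53\}$, $X_2=\{0,1,2,3,7,8,10,11,12,13,16,17,21,22,24,27,30,34,41,42,43,45,47,49\}$; (2) $X_1=\{0,1,2,3,5,6,7,9,11,12,14,15,17,19,23,24,25,26,29,32,33,39,40,43,45,48,52\}$, $X_2=\{0,1,2,3,4,5,9,11,14,15,16,18,22,26,27,31,32,34,37,39,41,42,45,51\}$; (3) $X_1=\{0,1,2,3,5,8,9,11,12,13,14,18,19,21,24,25,27,29,32,34,35,39,41,43,44,48,49\}$, $X_2=\{0,2,3,4,6,8,10,13,16,17,19,20,21,25,28,29,32,33,34,39,40,41,43,46\}$; (4) $X_1=\{0,2,3,4,6,7,8,10,11,14,16,17,18,20,23,25,26,28,31,32,36,37,38,41,42,47,49\}$, $X_2=\{0,1,2,3,5,8,9,10,12,16,17,18,22,25,28,30,35,37,41,44,45,46,48,49\}$. These SDS give four respective pairs $A,B$ of $\{\pm1\}$-sequences of length $58$ (the sequences associated to $X_1$ and $X_2$) with zero periodic autocorrelation function, i.e. $\mathrm{PAF}_A(s)+\mathrm{PAF}_B(s)=0$ for all $s=1,\ldots,57$.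
   Context: Subsets $X_1,X_2\subseteq\mathbb{Z}_v$ with $|X_1|=r$, $|X_2|=s$ are supplementary difference sets (SDS) with parameters $(v;r,s;\lambda)$ if $\lambda(v-1)=r(r-1)+s(s-1)$ and for every nonzero $c\in\mathbb{Z}_v$ the number of triples $(i,a,b)$ with $i\in\{1,2\}$, $a,b\in X_i$ and $a-b=c$ is exactly $\lambda$. Two SDS with the same parameters $(v;r,s;\lambda)$, where $r\neq s$, are equivalent if one is obtained from the other by a finite sequence of the following operations: replacing one block $X_i$ by a translate $X_i+c$; replacing one block $X_i$ by $-X_i$; replacing both blocks simultaneously by $uX_1,uX_2$ with $u$ an integer relatively prime to $v$. The sequence associated to $X\subseteq\mathbb{Z}_v$ is $A=[a_0,\ldots,a_{v-1}]$ with $a_j=-1$ if $j\in X$ and $a_j=1$ otherwise. For a sequence $A$ of length $v$ (indices modulo $v$), the periodic autocorrelation function is $\mathrm{PAF}_A(s)=\sum_{j=0}^{v-1}a_{j+s}\overline{a_j}$, $s\in\mathbb{Z}_v$. *)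

theory Defs
  imports Complex_Main
begin

(* Z_v is represented by the residues {0..<v} of type int; arithmetic is reduced mod v. *)
definition Zmod :: "nat \<Rightarrow> int set" where
  "Zmod v = {0..<int v}"

definition translate :: "nat \<Rightarrow> int \<Rightarrow> int set \<Rightarrow> int set" where
  "translate v c X = (\<lambda>x. (x + c) mod int v) ` X"

definition scale :: "nat \<Rightarrow> int \<Rightarrow> int set \<Rightarrow> int set" where
  "scale v u X = (\<lambda>x. (u * x) mod int v) ` X"

definition negate :: "nat \<Rightarrow> int set \<Rightarrow> int set" where
  "negate v X = (\<lambda>x. (- x) mod int v) ` X"

definition block :: "int set \<times> int set \<Rightarrow> nat \<Rightarrow> int set" where
  "block P i = (if i = 1 then fst P else snd P)"

definition is_SDS :: "nat \<Rightarrow> nat \<Rightarrow> nat \<Rightarrow> nat \<Rightarrow> int set \<times> int set \<Rightarrow> bool" where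
  "is_SDS v r s l P \<longleftrightarrow>
     block P 1 \<subseteq> Zmod v \<and> block P 2 \<subseteq> Zmod v \<and>
     card (block P 1) = r \<and> card (block P 2) = s \<and>
     int l * (int v - 1) = int r * (int r - 1) + int s * (int s - 1) \<and>
     (\<forall>c \<in> Zmod v - {0}.
        card {(i, a, b). i \<in> {1, 2} \<and> a \<in> block P i \<and> b \<in> block P i \<and>
                         (a - b) mod int v = c} = l)"

(* There is no operation exchanging the two blocks: this is the notion for r \<noteq> s. *)
inductive SDS_step :: "nat \<Rightarrow> int set \<times> int set \<Rightarrow> int set \<times> int set \<Rightarrow> bool"
  for v :: nat where
  translate_fst: "SDS_step v (X, Y) (translate v c X, Y)"
| translate_snd: "SDS_step v (X, Y) (X, translate v c Y)"
| negate_fst: "SDS_step v (X, Y) (negate v X, Y)"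
| negate_snd: "SDS_step v (X, Y) (X, negate v Y)"
| scale_both: "coprime u (int v) \<Longrightarrow> SDS_step v (X, Y) (scale v u X, scale v u Y)"

definition SDS_equivalent :: "nat \<Rightarrow> int set \<times> int set \<Rightarrow> int set \<times> int set \<Rightarrow> bool" where
  "SDS_equivalent v = (SDS_step v)\<^sup>*\<^sup>*"

definition assoc_seq :: "nat \<Rightarrow> int set \<Rightarrow> complex list" where
  "assoc_seq v X = map (\<lambda>j. if int j \<in> X then - 1 else 1) [0..<v]"

definition PAF :: "complex list \<Rightarrow> nat \<Rightarrow> complex" where
  "PAF A s = (\<Sum>j<length A. A ! ((j + s) mod length A) * cnj (A ! j))"

definition sds58 :: "(int set \<times> int set) list" where
  "sds58 =
    [({0,1,2,3,4,7,8,10,11,12,13,16,18,20,24,26,29,31,32,33,36,38,43,46,47,50,53},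
      {0,1,2,3,7,8,10,11,12,13,16,17,21,22,24,27,30,34,41,42,43,45,47,49}),
     ({0,1,2,3,5,6,7,9,11,12,14,15,17,19,23,24,25,26,29,32,33,39,40,43,45,48,52},
      {0,1,2,3,4,5,9,11,14,15,16,18,22,26,27,31,32,34,37,39,41,42,45,51}),
     ({0,1,2,3,5,8,9,11,12,13,14,18,19,21,24,25,27,29,32,34,35,39,41,43,44,48,49},
      {0,2,3,4,6,8,10,13,16,17,19,20,21,25,28,29,32,33,34,39,40,41,43,46}),
     ({0,2,3,4,6,7,8,10,11,14,16,17,18,20,23,25,26,28,31,32,36,37,38,41,42,47,49},
      {0,1,2,3,5,8,9,10,12,16,17,18,22,25,28,30,35,37,41,44,45,46,48,49})]"

end

(* For X \<subseteq> Z_v let N_X(c) be the number of ways to write c as a difference of two elements of X.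
   Translation and negation of X preserve N_X, and scaling by a unit u turns N_X(c) into
   N_uX(uc) = N_X(c). Hence the number of c with N_(X_1)(c) = 12 is an invariant of equivalence; it
   takes the values 28, 27, 23, 35 on the four pairs. Moreover PAF_A(s) = v - 4 |X| + 4 N_X(s)
   for the sequence A of X, so the autocorrelations of an SDS sum to 2v - 4 (r + s - \<lambda>), which is 0
   for the parameters at hand. *)

theory Submission
  imports Defs
begin

text \<open>A pair with difference c is determined by its subtrahend b, so only b is counted; this
  is the N_X(c) of the overview.\<close>

definition diff_count :: "nat \<Rightarrow> int set \<Rightarrow> int \<Rightarrow> nat" where
  "diff_count v X c = card {b \<in> X. (b + c) mod int v \<in> X}"

definition diff_level_count :: "nat \<Rightarrow> nat \<Rightarrow> int set \<Rightarrow> nat" where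
  "diff_level_count v k X = card {c \<in> Zmod v. diff_count v X c = k}"

text \<open>The common form of the three operations, with (u, t) equal to (1, c), (-1, 0) and (u,
  0), so that one invariance proof covers them all.\<close>

definition affine_image :: "nat \<Rightarrow> int \<Rightarrow> int \<Rightarrow> int set \<Rightarrow> int set" where
  "affine_image v u t X = (\<lambda>x. (u * x + t) mod int v) ` X"

lemma translate_eq_affine_image: "translate v c X = affine_image v 1 c X"
  by (simp add: translate_def affine_image_def)

lemma negate_eq_affine_image: "negate v X = affine_image v (- 1) 0 X"
  by (simp add: negate_def affine_image_def)

lemma scale_eq_affine_image: "scale v u X = affine_image v u 0 X"
  by (simp add: scale_def affine_image_def)

lemma finite_Zmod: "finite (Zmod v)"
  by (simp add: Zmod_def)

lemma Zmod_mod: "v > 0 \<Longrightarrow> x mod int v \<in> Zmod v"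
  by (simp add: Zmod_def)

lemma affine_image_subset_Zmod: "v > 0 \<Longrightarrow> affine_image v u t X \<subseteq> Zmod v"
  by (auto simp: affine_image_def Zmod_mod)

text \<open>Units can be cancelled modulo v, and reduced residues that are congruent modulo v are
  equal.\<close>

lemma inj_on_affine_Zmod:
  assumes "coprime u (int v)"
  shows "inj_on (\<lambda>x. (u * x + t) mod int v) (Zmod v)"
proof (rule inj_onI)
  fix x y assume xy: "x \<in> Zmod v" "y \<in> Zmod v" "(u * x + t) mod int v = (u * y + t) mod int v"
  then have "int v dvd u * (x - y)"
    by (simp add: mod_eq_dvd_iff algebra_simps)
  with assms have "int v dvd x - y"
    by (simp add: coprime_dvd_mult_right_iff coprime_commute)
  then have "x mod int v = y mod int v"
    by (simp add: mod_eq_dvd_iff)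
  with xy show "x = y"
    by (simp add: Zmod_def)
qed

lemma bij_betw_affine_Zmod:
  assumes "v > 0" "coprime u (int v)"
  shows "bij_betw (\<lambda>x. (u * x + t) mod int v) (Zmod v) (Zmod v)"
  unfolding bij_betw_def
  using assms by (intro conjI endo_inj_surj inj_on_affine_Zmod) (auto simp: finite_Zmod Zmod_mod)

text \<open>Differences lose t and are multiplied by u, and injectivity on Z_v ensures that no
  representation is created or lost.\<close>

lemma diff_count_affine_image:
  assumes v: "v > 0" and u: "coprime u (int v)" and X: "X \<subseteq> Zmod v"
  shows "diff_count v (affine_image v u t X) ((u * d) mod int v) = diff_count v X d"
proof -
  let ?f = "\<lambda>x. (u * x + t) mod int v"
  have inj: "inj_on ?f (Zmod v)"
    by (rule inj_on_affine_Zmod[OF u])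
  have shift: "(?f x + (u * d) mod int v) mod int v = ?f ((x + d) mod int v)" for x
  proof -
    have "(?f x + (u * d) mod int v) mod int v = ((u * x + t) + u * d) mod int v"
      by (rule mod_add_eq)
    also have "\<dots> = (u * (x + d) + t) mod int v"
      by (simp add: algebra_simps)
    also have "\<dots> = ?f ((x + d) mod int v)"
      by (metis mod_add_left_eq mod_mult_right_eq)
    finally show ?thesis .
  qed
  \<comment> \<open>Injectivity on all of \<open>Zmod v\<close> is used, not only on X, since (x +
    d) mod v may lie outside X.\<close>
  have mem: "?f ((x + d) mod int v) \<in> ?f ` X \<longleftrightarrow> (x + d) mod int v \<in> X" for x
    using inj_on_image_mem_iff[OF inj Zmod_mod[OF v] X] .
  have "{b \<in> ?f ` X. (b + (u * d) mod int v) mod int v \<in> ?f ` X}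
      = ?f ` {b \<in> X. (?f b + (u * d) mod int v) mod int v \<in> ?f ` X}"
    by blast
  also have "\<dots> = ?f ` {b \<in> X. (b + d) mod int v \<in> X}"
    by (simp only: shift mem)
  finally have "{b \<in> ?f ` X. (b + (u * d) mod int v) mod int v \<in> ?f ` X}
      = ?f ` {b \<in> X. (b + d) mod int v \<in> X}" .
  moreover have "inj_on ?f {b \<in> X. (b + d) mod int v \<in> X}"
    using X by (intro inj_on_subset[OF inj]) auto
  ultimately show ?thesis
    by (simp add: diff_count_def affine_image_def card_image)
qed

text \<open>Multiplication by u permutes Z_v and carries each level set of N_X onto the level set of
  the image for the same k.\<close>

lemma diff_level_count_affine_image:
  assumes v: "v > 0" and u: "coprime u (int v)" and X: "X \<subseteq> Zmod v"
  shows "diff_level_count v k (affine_image v u t X) = diff_level_count v k X"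
proof -
  let ?g = "\<lambda>d. (u * d) mod int v"
  have bij: "bij_betw ?g (Zmod v) (Zmod v)"
    using bij_betw_affine_Zmod[OF v u, of 0] by simp
  have "{c \<in> ?g ` Zmod v. diff_count v (affine_image v u t X) c = k}
      = ?g ` {c \<in> Zmod v. diff_count v (affine_image v u t X) (?g c) = k}"
    by blast
  then have "{c \<in> Zmod v. diff_count v (affine_image v u t X) c = k}
      = ?g ` {c \<in> Zmod v. diff_count v X c = k}"
    unfolding bij_betw_imp_surj_on[OF bij] diff_count_affine_image[OF assms] .
  moreover have "inj_on ?g {c \<in> Zmod v. diff_count v X c = k}"
    using bij by (auto simp: bij_betw_def intro: inj_on_subset)
  ultimately show ?thesis
    by (simp add: diff_level_count_def card_image)
qed

text \<open>The inclusion in \<open>Zmod v\<close> is carried along so that the claim can be chained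
  over several steps. Steps on the second block leave the first as it is.\<close>

lemma SDS_step_diff_level_count:
  assumes "SDS_step v P Q" "v > 0" "fst P \<subseteq> Zmod v"
  shows "fst Q \<subseteq> Zmod v \<and> diff_level_count v k (fst Q) = diff_level_count v k (fst P)"
  using assms
  by cases (auto simp: translate_eq_affine_image negate_eq_affine_image scale_eq_affine_image
      diff_level_count_affine_image dest: subsetD[OF affine_image_subset_Zmod])

lemma SDS_equivalent_diff_level_count:
  assumes "SDS_equivalent v P Q" "v > 0" "fst P \<subseteq> Zmod v"
  shows "diff_level_count v k (fst Q) = diff_level_count v k (fst P)"
proof -
  have "fst Q \<subseteq> Zmod v \<and> diff_level_count v k (fst Q) = diff_level_count v k (fst P)"
    using assms(1) unfolding SDS_equivalent_def
  proof induction
    case base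
    show ?case using assms(3) by simp
  next
    case (step Q R)
    then show ?case using SDS_step_diff_level_count[OF step.hyps(2) assms(2)] by simp
  qed
  then show ?thesis ..
qed

text \<open>The triples split by i, and within each block a is forced to be (b + c) mod v; what
  remains are the two sets of admissible b.\<close>

lemma card_SDS_triples:
  assumes v: "v > 0" and X: "X \<subseteq> Zmod v" and Y: "Y \<subseteq> Zmod v" and c: "c \<in> Zmod v"
  shows "card {(i, a, b). i \<in> {1, 2} \<and> a \<in> block (X, Y) i \<and> b \<in> block (X, Y) i \<and>
           (a - b) mod int v = c} = diff_count v X c + diff_count v Y c"
proof -
  let ?D = "\<lambda>X. {b \<in> X. (b + c) mod int v \<in> X}"
  let ?h = "\<lambda>(i::nat) b. (i, (b + c) mod int v, b)"
  have diff: "(a - b) mod int v = c \<longleftrightarrow> a = (b + c) mod int v" if "a \<in> Zmod v" for a b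
  proof -
    have "a mod int v = a" "c mod int v = c"
      using that c by (simp_all add: Zmod_def)
    then show ?thesis
      by (metis add_diff_cancel_left' diff_add_cancel mod_add_right_eq mod_diff_left_eq add.commute)
  qed
  have block: "block (X, Y) i \<subseteq> Zmod v" for i
    using X Y by (simp add: block_def)
  have "a \<in> block (X, Y) i \<and> b \<in> block (X, Y) i \<and> (a - b) mod int v = c \<longleftrightarrow>
      b \<in> block (X, Y) i \<and> (b + c) mod int v \<in> block (X, Y) i \<and> a = (b + c) mod int v" for i a b
  proof (cases "a \<in> Zmod v")
    case True
    show ?thesis unfolding diff[OF True] by blast
  next
    case False
    \<comment> \<open>Both sides fail: each would put a into the block, hence into
      \<open>Zmod v\<close>.\<close>
    then show ?thesis using block[of i] by blast
  qed
  then have "{(i, a, b). i \<in> {1, 2} \<and> a \<in> block (X, Y) i \<and> b \<in> block (X, Y) i \<and>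
           (a - b) mod int v = c} = ?h 1 ` ?D X \<union> ?h 2 ` ?D Y"
    by (auto simp: block_def)
  moreover have "finite (?D X)" "finite (?D Y)"
    using X Y finite_Zmod by (auto intro: finite_subset)
  ultimately show ?thesis
    by (simp add: diff_count_def, subst card_Un_disjoint) (auto simp: card_image inj_on_def)
qed

text \<open>With the indicator \<open>\<chi>\<close> of X the entries are 1 - 2
  \<open>\<chi>\<close>, which are real, so conjugation drops out. Expanding the product gives two
  linear sums, each |X|, and a quadratic one equal to N_X(s).\<close>

lemma PAF_assoc_seq:
  assumes v: "v > 0" and X: "X \<subseteq> Zmod v"
  shows "PAF (assoc_seq v X) s
    = of_nat v - 4 * of_nat (card X) + 4 * of_nat (diff_count v X (int s))"
proof -
  define \<chi> :: "int \<Rightarrow> complex" where "\<chi> x = of_bool (x \<in> X)" for x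
  let ?m = "\<lambda>x. (x + int s) mod int v"
  \<comment> \<open>Moves the sum from list positions to residues of type \<open>int\<close>, where
    the affine lemmas apply.\<close>
  have Zmod: "Zmod v = int ` {..<v}"
    by (auto simp: Zmod_def image_iff intro: zero_le_imp_eq_int)
       (metis nat_less_iff int_nat_eq lessThan_iff)
  have "PAF (assoc_seq v X) s = (\<Sum>j<v. (1 - 2 * \<chi> (?m (int j))) * (1 - 2 * \<chi> (int j)))"
    unfolding PAF_def using v
    by (intro sum.cong) (auto simp: assoc_seq_def \<chi>_def zmod_int)
  also have "\<dots> = (\<Sum>x\<in>Zmod v. (1 - 2 * \<chi> (?m x)) * (1 - 2 * \<chi> x))"
    unfolding Zmod by (simp add: sum.reindex)
  also have "\<dots> = of_nat (card (Zmod v)) - 2 * (\<Sum>x\<in>Zmod v. \<chi> (?m x)) - 2 * (\<Sum>x\<in>Zmod v. \<chi> x)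
      + 4 * (\<Sum>x\<in>Zmod v. \<chi> (?m x) * \<chi> x)"
    by (simp add: algebra_simps sum.distrib sum_subtractf sum_distrib_left)
  \<comment> \<open>The shift by s permutes Z_v: the affine bijection with u = 1.\<close>
  also have "(\<Sum>x\<in>Zmod v. \<chi> (?m x)) = (\<Sum>x\<in>Zmod v. \<chi> x)"
    using sum.reindex_bij_betw[OF bij_betw_affine_Zmod[OF v, of 1 "int s"]] by simp
  also have "(\<Sum>x\<in>Zmod v. \<chi> x) = of_nat (card X)"
    using X by (simp add: \<chi>_def sum.If_cases finite_Zmod of_bool_def Int_absorb1)
  also have "(\<Sum>x\<in>Zmod v. \<chi> (?m x) * \<chi> x) = (\<Sum>x\<in>Zmod v. of_bool (x \<in> X \<and> ?m x \<in> X))"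
    by (intro sum.cong) (auto simp: \<chi>_def)
  also have "\<dots> = of_nat (card (Zmod v \<inter> {x. x \<in> X \<and> ?m x \<in> X}))"
    by (simp add: sum.If_cases finite_Zmod of_bool_def)
  also have "Zmod v \<inter> {x. x \<in> X \<and> ?m x \<in> X} = {x \<in> X. ?m x \<in> X}"
    using X by auto
  finally show ?thesis
    by (simp add: diff_count_def Zmod_def)
qed

text \<open>An executable form; \<open>remdups\<close> makes the length a cardinality even if xs
  repeats elements.\<close>

lemma diff_count_set [code]:
  "diff_count v (set xs) c = length (filter (\<lambda>b. (b + c) mod int v \<in> set xs) (remdups xs))"
proof -
  have "{b \<in> set xs. (b + c) mod int v \<in> set xs}
      = set (filter (\<lambda>b. (b + c) mod int v \<in> set xs) (remdups xs))"
    by auto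
  then show ?thesis
    unfolding diff_count_def by (metis distinct_card distinct_filter distinct_remdups)
qed

lemma diff_level_count_code [code]:
  "diff_level_count v k X = length (filter (\<lambda>c. diff_count v X c = k) [0..int v - 1])"
proof -
  have "{c \<in> Zmod v. diff_count v X c = k} = set (filter (\<lambda>c. diff_count v X c = k) [0..int v - 1])"
    by (auto simp: Zmod_def)
  then show ?thesis
    unfolding diff_level_count_def by (metis distinct_card distinct_filter distinct_upto)
qed

text \<open>Level 12, next to the mean 27 * 26 / 57 of N_X over the nonzero residues, already
  separates the pairs: the four values are distinct.\<close>

lemma sds58_diff_level_counts:
  "map (\<lambda>P. diff_level_count 58 12 (fst P)) sds58 = [28, 27, 23, 35]"
  by code_simp

text \<open>This one finite check feeds both the SDS property and the vanishing of the
  autocorrelation sums.\<close>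

lemma sds58_diff_counts:
  "\<forall>P \<in> set sds58. \<forall>c \<in> set [1..57]. diff_count 58 (fst P) c + diff_count 58 (snd P) c = 22"
  by code_simp

lemma sds58_cards:
  "\<forall>P \<in> set sds58. card (fst P) = 27 \<and> card (snd P) = 24"
  by code_simp

lemma sds58_subset_Zmod:
  "\<forall>P \<in> set sds58. fst P \<subseteq> Zmod 58 \<and> snd P \<subseteq> Zmod 58"
  by (simp add: sds58_def Zmod_def)

theorem mainTheorem3:
  shows "(\<forall>i<4. is_SDS 58 27 24 22 (sds58 ! i)) \<and>
         (\<forall>i<4. \<forall>j<4. i \<noteq> j \<longrightarrow> \<not> SDS_equivalent 58 (sds58 ! i) (sds58 ! j)) \<and>
         (\<forall>i<4. \<forall>A B. A = assoc_seq 58 (fst (sds58 ! i)) \<and> B = assoc_seq 58 (snd (sds58 ! i)) \<longrightarrow>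
            length A = 58 \<and> length B = 58 \<and> set A \<subseteq> {1, -1} \<and> set B \<subseteq> {1, -1} \<and>
            (\<forall>s\<in>{1..57}. PAF A s + PAF B s = 0))"
proof (intro conjI)
  have len: "length sds58 = 4"
    by (simp add: sds58_def)
  have sub: "fst (sds58 ! i) \<subseteq> Zmod 58" "snd (sds58 ! i) \<subseteq> Zmod 58"
    and card: "card (fst (sds58 ! i)) = 27" "card (snd (sds58 ! i)) = 24" if "i < 4" for i
    using that len sds58_subset_Zmod sds58_cards by simp_all
  have diff: "diff_count 58 (fst (sds58 ! i)) c + diff_count 58 (snd (sds58 ! i)) c = 22"
    if "i < 4" "1 \<le> c" "c \<le> 57" for i c
    using that len sds58_diff_counts by simp
  show "\<forall>i<4. is_SDS 58 27 24 22 (sds58 ! i)"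
  proof (intro allI impI)
    fix i :: nat assume i: "i < 4"
    have "card {(j, a, b). j \<in> {1, 2} \<and> a \<in> block (sds58 ! i) j \<and> b \<in> block (sds58 ! i) j \<and>
            (a - b) mod int 58 = c} = 22" if c: "c \<in> Zmod 58 - {0}" for c
    proof -
      have "1 \<le> c" "c \<le> 57"
        using c by (auto simp: Zmod_def)
      then show ?thesis
        using card_SDS_triples[OF _ sub[OF i], of c] c diff[OF i] by simp
    qed
    \<comment> \<open>Besides the triple counts this takes the parameter identity 22 * 57 = 27 * 26
      + 24 * 23.\<close>
    then show "is_SDS 58 27 24 22 (sds58 ! i)"
      using sub[OF i] card[OF i] by (simp add: is_SDS_def block_def)
  qed
  show "\<forall>i<4. \<forall>j<4. i \<noteq> j \<longrightarrow> \<not> SDS_equivalent 58 (sds58 ! i) (sds58 ! j)"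
  proof (intro allI impI notI)
    fix i j :: nat assume ij: "i < 4" "j < 4" "i \<noteq> j"
      and "SDS_equivalent 58 (sds58 ! i) (sds58 ! j)"
    then have "diff_level_count 58 12 (fst (sds58 ! j)) = diff_level_count 58 12 (fst (sds58 ! i))"
      using SDS_equivalent_diff_level_count sub(1) by simp
    moreover have "diff_level_count 58 12 (fst (sds58 ! n)) = [28, 27, 23, 35] ! n" if "n < 4" for n
      using that len sds58_diff_level_counts by (metis nth_map)
    \<comment> \<open>Distinct values turn equality of the invariants into i = j.\<close>
    moreover have "distinct [28, 27, 23, 35::nat]"
      by simp
    ultimately show False
      using ij nth_eq_iff_index_eq[of "[28, 27, 23, 35::nat]" i j] by simp
  qed
  have "PAF (assoc_seq 58 (fst (sds58 ! i))) s + PAF (assoc_seq 58 (snd (sds58 ! i))) s = 0"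
    if i: "i < 4" and s: "s \<in> {1..57}" for i s
  proof -
    have "of_nat (diff_count 58 (fst (sds58 ! i)) (int s))
        + of_nat (diff_count 58 (snd (sds58 ! i)) (int s)) = (22 :: complex)"
      using diff[OF i, of "int s"] s by (simp flip: of_nat_add)
    \<comment> \<open>The constant is 2 * 58 - 4 * (27 + 24) = -88, which cancels 4 * 22.\<close>
    moreover have "PAF (assoc_seq 58 (fst (sds58 ! i))) s + PAF (assoc_seq 58 (snd (sds58 ! i))) s
        = 4 * (of_nat (diff_count 58 (fst (sds58 ! i)) (int s))
             + of_nat (diff_count 58 (snd (sds58 ! i)) (int s))) - 88"
      by (simp add: PAF_assoc_seq sub[OF i] card[OF i] algebra_simps)
    ultimately show ?thesis
      by simp
  qed
  then show "\<forall>i<4. \<forall>A B. A = assoc_seq 58 (fst (sds58 ! i)) \<and> B = assoc_seq 58 (snd (sds58 ! i)) \<longrightarrow>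
            length A = 58 \<and> length B = 58 \<and> set A \<subseteq> {1, -1} \<and> set B \<subseteq> {1, -1} \<and>
            (\<forall>s\<in>{1..57}. PAF A s + PAF B s = 0)"
    by (auto simp: assoc_seq_def)
qed

end
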